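(* Let $S$ be a semiring and let $I$ be an ideal of $S$. (i) If $J$ is a $k$-strongly irreducible ideal of $S$ containing $I$, then $J/I$ is a $k$-strongly irreducible ideal of $S/I$. (ii) Conversely, if $S$ is an arithmetic $k$-semiring and $J$ is an ideal of $S$ containing $I$ such that $J/I$ is $k$-strongly irreducible in $S/I$, then $J$ is $k$-strongly irreducible in $S$.
   Context: A semiring is a commutative semiring $(S,+,0,\cdot,1)$ with multiplicative identity $1$ and additive identity $0$ that is absorbing. An ideal is a nonempty subset closed under addition and under multiplication by elements of $S$. A $k$-ideal is an ideal $I$ such that $x+y\in I$ and $y\in I$ imply $x\in I$. $S$ is a $k$-semiring if every ideal of $S$ is a $k$-ideal. $S$ is arithmetic if its lattice of ideals is distributive, i.e. $A+(B\cap C)=(A+B)\cap(A+C)$ for all ideals $A,B,C$. A $k$-ideal $I$ is $k$-strongly irreducible if for all $k$-ideals $A,B$ of the semiring, $A\cap B\subseteq I$ implies $A\subseteq I$ or $B\subseteq I$. For an ideal $I$, $S/I$ denotes the quotient semiring of $S$ by the Bourne congruence $K_I$: $a\,K_I\,b$ iff $a+i=b+j$ for some $i,j\in I$; the class of $r$ is written $r+I$. For an ideal $J\supseteq I$, $J/I=\{j+I: j\in J\}\subseteq S/I$. *)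

theory Defs
  imports "HOL-Algebra.AbelCoset"
begin

text \<open>Unlike the type class for commutative semirings, this locale allows \<open>0 = 1\<close>, which is
  needed since the quotient by an ideal may be trivial.\<close>

locale comm_semiring = semiring + comm_monoid R

definition semiring_ideal :: "'a set \<Rightarrow> ('a, 'm) ring_scheme \<Rightarrow> bool" where
  "semiring_ideal A S \<longleftrightarrow>
     A \<subseteq> carrier S \<and> A \<noteq> {} \<and>
     (\<forall>x\<in>A. \<forall>y\<in>A. x \<oplus>\<^bsub>S\<^esub> y \<in> A) \<and>
     (\<forall>s\<in>carrier S. \<forall>x\<in>A. s \<otimes>\<^bsub>S\<^esub> x \<in> A)"

definition k_ideal :: "'a set \<Rightarrow> ('a, 'm) ring_scheme \<Rightarrow> bool" where
  "k_ideal A S \<longleftrightarrow>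
     semiring_ideal A S \<and>
     (\<forall>x\<in>carrier S. \<forall>y\<in>carrier S. x \<oplus>\<^bsub>S\<^esub> y \<in> A \<and> y \<in> A \<longrightarrow> x \<in> A)"

definition k_semiring :: "('a, 'm) ring_scheme \<Rightarrow> bool" where
  "k_semiring S \<longleftrightarrow> (\<forall>A. semiring_ideal A S \<longrightarrow> k_ideal A S)"

definition arithmetic :: "('a, 'm) ring_scheme \<Rightarrow> bool" where
  "arithmetic S \<longleftrightarrow>
     (\<forall>A B C. semiring_ideal A S \<and> semiring_ideal B S \<and> semiring_ideal C S \<longrightarrow>
        A <+>\<^bsub>S\<^esub> (B \<inter> C) = (A <+>\<^bsub>S\<^esub> B) \<inter> (A <+>\<^bsub>S\<^esub> C))"

definition k_strongly_irreducible :: "'a set \<Rightarrow> ('a, 'm) ring_scheme \<Rightarrow> bool" where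
  "k_strongly_irreducible I S \<longleftrightarrow>
     k_ideal I S \<and>
     (\<forall>A B. k_ideal A S \<and> k_ideal B S \<and> A \<inter> B \<subseteq> I \<longrightarrow> A \<subseteq> I \<or> B \<subseteq> I)"

definition bourne_rel :: "('a, 'm) ring_scheme \<Rightarrow> 'a set \<Rightarrow> ('a \<times> 'a) set" where
  "bourne_rel S I =
     {(a, b). a \<in> carrier S \<and> b \<in> carrier S \<and> (\<exists>i\<in>I. \<exists>j\<in>I. a \<oplus>\<^bsub>S\<^esub> i = b \<oplus>\<^bsub>S\<^esub> j)}"

text \<open>The class written \<open>r + I\<close>; it contains the set \<open>{r + i | i \<in> I}\<close>, but need not equal it.\<close>

definition bourne_class :: "('a, 'm) ring_scheme \<Rightarrow> 'a set \<Rightarrow> 'a \<Rightarrow> 'a set" where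
  "bourne_class S I r = bourne_rel S I `` {r}"

text \<open>The operations are unions over all choices of representatives; by
  \<open>bourne_class_add\<close> and \<open>bourne_class_mult\<close> below, each such union is a single class.\<close>

definition bourne_quotient :: "('a, 'm) ring_scheme \<Rightarrow> 'a set \<Rightarrow> 'a set ring" where
  "bourne_quotient S I =
     \<lparr>carrier = carrier S // bourne_rel S I,
      mult = (\<lambda>X Y. \<Union>x\<in>X. \<Union>y\<in>Y. bourne_class S I (x \<otimes>\<^bsub>S\<^esub> y)),
      one = bourne_class S I \<one>\<^bsub>S\<^esub>,
      zero = bourne_class S I \<zero>\<^bsub>S\<^esub>,
      add = (\<lambda>X Y. \<Union>x\<in>X. \<Union>y\<in>Y. bourne_class S I (x \<oplus>\<^bsub>S\<^esub> y))\<rparr>"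

definition quotient_ideal :: "('a, 'm) ring_scheme \<Rightarrow> 'a set \<Rightarrow> 'a set \<Rightarrow> 'a set set" where
  "quotient_ideal S J I = bourne_class S I ` J"

context comm_semiring
begin

lemma equiv_bourne_rel:
  assumes I: "semiring_ideal I R"
  shows "equiv (carrier R) (bourne_rel R I)"
proof (rule equivI)
  have sub: "I \<subseteq> carrier R" and ne: "I \<noteq> {}"
    and add: "\<And>x y. x \<in> I \<Longrightarrow> y \<in> I \<Longrightarrow> x \<oplus> y \<in> I"
    using I by (auto simp: semiring_ideal_def)
  show "bourne_rel R I \<subseteq> carrier R \<times> carrier R"
    by (auto simp: bourne_rel_def)
  show "refl_on (carrier R) (bourne_rel R I)"
    using ne by (auto simp: refl_on_def bourne_rel_def)
  show "sym (bourne_rel R I)"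
    by (rule symI) (force simp: bourne_rel_def)
  show "trans (bourne_rel R I)"
  proof (rule transI)
    fix a b c assume "(a, b) \<in> bourne_rel R I" "(b, c) \<in> bourne_rel R I"
    then obtain i j k l where car: "a \<in> carrier R" "b \<in> carrier R" "c \<in> carrier R"
      and mem: "i \<in> I" "j \<in> I" "k \<in> I" "l \<in> I"
      and eq: "a \<oplus> i = b \<oplus> j" "b \<oplus> k = c \<oplus> l"
      by (auto simp: bourne_rel_def)
    have memc: "i \<in> carrier R" "j \<in> carrier R" "k \<in> carrier R" "l \<in> carrier R"
      using mem sub by auto
    have "a \<oplus> (i \<oplus> k) = (a \<oplus> i) \<oplus> k" using car memc by (simp add: a_assoc)
    also have "\<dots> = (b \<oplus> j) \<oplus> k" by (simp only: eq(1))
    also have "\<dots> = (b \<oplus> k) \<oplus> j" using car memc by (simp add: a_ac)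
    also have "\<dots> = (c \<oplus> l) \<oplus> j" by (simp only: eq(2))
    also have "\<dots> = c \<oplus> (l \<oplus> j)" using car memc by (simp add: a_assoc)
    finally show "(a, c) \<in> bourne_rel R I"
      using car mem add unfolding bourne_rel_def by blast
  qed
qed

lemma bourne_rel_add:
  assumes I: "semiring_ideal I R"
    and "(a, a') \<in> bourne_rel R I" "(b, b') \<in> bourne_rel R I"
  shows "(a \<oplus> b, a' \<oplus> b') \<in> bourne_rel R I"
proof -
  have sub: "I \<subseteq> carrier R" and add: "\<And>x y. x \<in> I \<Longrightarrow> y \<in> I \<Longrightarrow> x \<oplus> y \<in> I"
    using I by (auto simp: semiring_ideal_def)
  from assms obtain i j k l
    where car: "a \<in> carrier R" "a' \<in> carrier R" "b \<in> carrier R" "b' \<in> carrier R"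
      and mem: "i \<in> I" "j \<in> I" "k \<in> I" "l \<in> I"
      and eq: "a \<oplus> i = a' \<oplus> j" "b \<oplus> k = b' \<oplus> l"
    by (auto simp: bourne_rel_def)
  have memc: "i \<in> carrier R" "j \<in> carrier R" "k \<in> carrier R" "l \<in> carrier R"
    using mem sub by auto
  have "(a \<oplus> b) \<oplus> (i \<oplus> k) = (a \<oplus> i) \<oplus> (b \<oplus> k)" using car memc by (simp add: a_ac)
  also have "\<dots> = (a' \<oplus> b') \<oplus> (j \<oplus> l)" (is "?l = ?r")
  proof -
    have "?l = (a' \<oplus> j) \<oplus> (b' \<oplus> l)" by (simp only: eq)
    also have "\<dots> = ?r" using car memc by (simp add: a_ac)
    finally show ?thesis .
  qed
  finally show ?thesis
    using car mem add unfolding bourne_rel_def by blast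
qed

lemma bourne_rel_mult_left:
  assumes I: "semiring_ideal I R"
    and "s \<in> carrier R" "(a, b) \<in> bourne_rel R I"
  shows "(s \<otimes> a, s \<otimes> b) \<in> bourne_rel R I"
proof -
  have sub: "I \<subseteq> carrier R" and mult: "\<And>x. x \<in> I \<Longrightarrow> s \<otimes> x \<in> I"
    using I assms(2) by (auto simp: semiring_ideal_def)
  from assms obtain i j where car: "a \<in> carrier R" "b \<in> carrier R"
      and mem: "i \<in> I" "j \<in> I" and eq: "a \<oplus> i = b \<oplus> j"
    by (auto simp: bourne_rel_def)
  have "s \<otimes> a \<oplus> s \<otimes> i = s \<otimes> b \<oplus> s \<otimes> j"
    using car mem sub assms(2) eq by (metis r_distr subsetD)
  with car mem mult assms(2) show ?thesis
    unfolding bourne_rel_def by blast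
qed

lemma bourne_rel_mult:
  assumes I: "semiring_ideal I R"
    and "(a, a') \<in> bourne_rel R I" "(b, b') \<in> bourne_rel R I"
  shows "(a \<otimes> b, a' \<otimes> b') \<in> bourne_rel R I"
proof -
  have car: "a \<in> carrier R" "a' \<in> carrier R" "b \<in> carrier R" "b' \<in> carrier R"
    using assms by (auto simp: bourne_rel_def)
  have "(a \<otimes> b, a \<otimes> b') \<in> bourne_rel R I"
    using bourne_rel_mult_left[OF I car(1) assms(3)] .
  moreover have "(a \<otimes> b', a' \<otimes> b') \<in> bourne_rel R I"
    using bourne_rel_mult_left[OF I car(4) assms(2)] car by (simp add: m_comm)
  ultimately show ?thesis
    using equiv_bourne_rel[OF I] by (meson equivE transE)
qed

lemma bourne_class_eq_iff:
  assumes "semiring_ideal I R" "a \<in> carrier R" "b \<in> carrier R"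
  shows "bourne_class R I a = bourne_class R I b \<longleftrightarrow> (a, b) \<in> bourne_rel R I"
  unfolding bourne_class_def
  using eq_equiv_class_iff[OF equiv_bourne_rel[OF assms(1)] assms(2,3)] .

lemma bourne_class_self:
  assumes "semiring_ideal I R" "a \<in> carrier R"
  shows "a \<in> bourne_class R I a"
  unfolding bourne_class_def
  using equiv_class_self[OF equiv_bourne_rel[OF assms(1)] assms(2)] .

lemma bourne_class_add:
  assumes I: "semiring_ideal I R" and car: "a \<in> carrier R" "b \<in> carrier R"
  shows "bourne_class R I a \<oplus>\<^bsub>bourne_quotient R I\<^esub> bourne_class R I b
           = bourne_class R I (a \<oplus> b)"
proof -
  have "bourne_class R I (x \<oplus> y) = bourne_class R I (a \<oplus> b)"
    if "x \<in> bourne_class R I a" "y \<in> bourne_class R I b" for x y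
  proof -
    have r: "(a, x) \<in> bourne_rel R I" "(b, y) \<in> bourne_rel R I"
      using that by (auto simp: bourne_class_def)
    then have "(a \<oplus> b, x \<oplus> y) \<in> bourne_rel R I" by (rule bourne_rel_add[OF I])
    then show ?thesis
      using equiv_class_eq[OF equiv_bourne_rel[OF I]] by (simp add: bourne_class_def)
  qed
  then have "(\<Union>x\<in>bourne_class R I a. \<Union>y\<in>bourne_class R I b. bourne_class R I (x \<oplus> y))
      = (\<Union>x\<in>bourne_class R I a. \<Union>y\<in>bourne_class R I b. bourne_class R I (a \<oplus> b))"
    by (intro SUP_cong refl)
  then show ?thesis
    using bourne_class_self[OF I car(1)] bourne_class_self[OF I car(2)]
    unfolding bourne_quotient_def by fastforce
qed

lemma bourne_class_mult:
  assumes I: "semiring_ideal I R" and car: "a \<in> carrier R" "b \<in> carrier R"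
  shows "bourne_class R I a \<otimes>\<^bsub>bourne_quotient R I\<^esub> bourne_class R I b
           = bourne_class R I (a \<otimes> b)"
proof -
  have "bourne_class R I (x \<otimes> y) = bourne_class R I (a \<otimes> b)"
    if "x \<in> bourne_class R I a" "y \<in> bourne_class R I b" for x y
  proof -
    have r: "(a, x) \<in> bourne_rel R I" "(b, y) \<in> bourne_rel R I"
      using that by (auto simp: bourne_class_def)
    then have "(a \<otimes> b, x \<otimes> y) \<in> bourne_rel R I" by (rule bourne_rel_mult[OF I])
    then show ?thesis
      using equiv_class_eq[OF equiv_bourne_rel[OF I]] by (simp add: bourne_class_def)
  qed
  then have "(\<Union>x\<in>bourne_class R I a. \<Union>y\<in>bourne_class R I b. bourne_class R I (x \<otimes> y))
      = (\<Union>x\<in>bourne_class R I a. \<Union>y\<in>bourne_class R I b. bourne_class R I (a \<otimes> b))"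
    by (intro SUP_cong refl)
  then show ?thesis
    using bourne_class_self[OF I car(1)] bourne_class_self[OF I car(2)]
    unfolding bourne_quotient_def by fastforce
qed

lemma carrier_bourne_quotient:
  "carrier (bourne_quotient R I) = bourne_class R I ` carrier R"
  by (auto simp: bourne_quotient_def bourne_class_def quotient_def)

lemma zero_bourne_quotient: "\<zero>\<^bsub>bourne_quotient R I\<^esub> = bourne_class R I \<zero>"
  and one_bourne_quotient: "\<one>\<^bsub>bourne_quotient R I\<^esub> = bourne_class R I \<one>"
  by (simp_all add: bourne_quotient_def)

theorem comm_semiring_bourne_quotient:
  assumes I: "semiring_ideal I R"
  shows "comm_semiring (bourne_quotient R I)"
proof -
  note simps = carrier_bourne_quotient zero_bourne_quotient one_bourne_quotient
    bourne_class_add[OF I] bourne_class_mult[OF I]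
  have add: "abelian_monoid (bourne_quotient R I)"
    by (rule abelian_monoidI) (auto simp: simps a_ac)
  have mult: "comm_monoid (bourne_quotient R I)"
    by (rule comm_monoidI) (auto simp: simps m_ac)
  have "semiring (bourne_quotient R I)"
    by (intro semiring.intro semiring_axioms.intro add comm_monoid.axioms(1)[OF mult])
       (auto simp: simps l_distr r_distr)
  then show ?thesis
    by (intro comm_semiring.intro mult)
qed

end

end

(* Between the k-ideals of S containing I and the k-ideals of S/I, image and preimage under
   r \<mapsto> r + I are mutually inverse, because a k-ideal J containing I satisfies
   r + I \<in> J/I \<longleftrightarrow> r \<in> J. For (i), pull two k-ideals of S/I back to S. For (ii), replace
   k-ideals A, B of S by I + A and I + B: these contain I, and arithmeticity gives
   (I + A) \<inter> (I + B) = I + (A \<inter> B) \<subseteq> J, so their images in S/I can be compared with J/I. *)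

theory Submission
  imports Defs
begin

lemma k_ideal_imp_semiring_ideal: "k_ideal A S \<Longrightarrow> semiring_ideal A S"
  by (simp add: k_ideal_def)

lemma semiring_ideal_subset: "semiring_ideal A S \<Longrightarrow> A \<subseteq> carrier S"
  by (simp add: semiring_ideal_def)

lemma semiring_ideal_add:
  "semiring_ideal A S \<Longrightarrow> x \<in> A \<Longrightarrow> y \<in> A \<Longrightarrow> x \<oplus>\<^bsub>S\<^esub> y \<in> A"
  by (simp add: semiring_ideal_def)

lemma semiring_ideal_mult:
  "semiring_ideal A S \<Longrightarrow> s \<in> carrier S \<Longrightarrow> x \<in> A \<Longrightarrow> s \<otimes>\<^bsub>S\<^esub> x \<in> A"
  by (simp add: semiring_ideal_def)

lemma k_ideal_cancel:
  "k_ideal A S \<Longrightarrow> x \<in> carrier S \<Longrightarrow> y \<in> carrier S \<Longrightarrow> x \<oplus>\<^bsub>S\<^esub> y \<in> A \<Longrightarrow> y \<in> A \<Longrightarrow> x \<in> A"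
  by (auto simp: k_ideal_def)

context comm_semiring
begin

text \<open>Zero is absorbing, so multiplying any element of the nonempty set \<open>A\<close> by
  \<open>\<zero>\<close> gives \<open>\<zero>\<close>.\<close>

lemma semiring_ideal_zero:
  assumes "semiring_ideal A R"
  shows "\<zero> \<in> A"
proof -
  obtain x where "x \<in> A" using assms by (auto simp: semiring_ideal_def)
  then show ?thesis
    using semiring_ideal_mult[OF assms zero_closed] semiring_ideal_subset[OF assms] by force
qed

lemma mem_set_add_iff: "x \<in> A <+>\<^bsub>R\<^esub> B \<longleftrightarrow> (\<exists>a\<in>A. \<exists>b\<in>B. x = a \<oplus> b)"
  unfolding set_add_def' by blast

text \<open>Needed to enlarge an ideal of the semiring to one that contains \<open>I\<close>, the
  only ideals that the quotient can see faithfully.\<close>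

lemma semiring_ideal_set_add:
  assumes A: "semiring_ideal A R" and B: "semiring_ideal B R"
  shows "semiring_ideal (A <+>\<^bsub>R\<^esub> B) R"
proof -
  note sub = subsetD[OF semiring_ideal_subset[OF A]] subsetD[OF semiring_ideal_subset[OF B]]
  have "x \<oplus> y \<in> A <+>\<^bsub>R\<^esub> B" if xy: "x \<in> A <+>\<^bsub>R\<^esub> B" "y \<in> A <+>\<^bsub>R\<^esub> B" for x y
  proof -
    obtain a b c d where mem: "a \<in> A" "b \<in> B" "c \<in> A" "d \<in> B"
      and eq: "x = a \<oplus> b" "y = c \<oplus> d"
      using xy unfolding mem_set_add_iff by blast
    have "x \<oplus> y = (a \<oplus> c) \<oplus> (b \<oplus> d)"
      using mem by (simp add: eq sub a_ac)
    then show ?thesis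
      using semiring_ideal_add[OF A] semiring_ideal_add[OF B] mem unfolding mem_set_add_iff by blast
  qed
  moreover have "s \<otimes> x \<in> A <+>\<^bsub>R\<^esub> B" if s: "s \<in> carrier R" and x: "x \<in> A <+>\<^bsub>R\<^esub> B" for s x
  proof -
    obtain a b where mem: "a \<in> A" "b \<in> B" and eq: "x = a \<oplus> b"
      using x unfolding mem_set_add_iff by blast
    have "s \<otimes> x = s \<otimes> a \<oplus> s \<otimes> b"
      using mem s by (simp add: eq sub r_distr)
    then show ?thesis
      using semiring_ideal_mult[OF A s] semiring_ideal_mult[OF B s] mem
      unfolding mem_set_add_iff by blast
  qed
  moreover have "A <+>\<^bsub>R\<^esub> B \<subseteq> carrier R" by (auto simp: mem_set_add_iff sub)
  moreover have "A <+>\<^bsub>R\<^esub> B \<noteq> {}"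
    using semiring_ideal_zero[OF A] semiring_ideal_zero[OF B] mem_set_add_iff by blast
  ultimately show ?thesis by (simp add: semiring_ideal_def)
qed

lemma set_add_superset:
  assumes A: "semiring_ideal A R" and B: "semiring_ideal B R"
  shows "A \<subseteq> A <+>\<^bsub>R\<^esub> B" "B \<subseteq> A <+>\<^bsub>R\<^esub> B"
proof -
  note sub = subsetD[OF semiring_ideal_subset[OF A]] subsetD[OF semiring_ideal_subset[OF B]]
  show "A \<subseteq> A <+>\<^bsub>R\<^esub> B"
  proof
    fix a assume "a \<in> A"
    then have "a = a \<oplus> \<zero>" by (simp add: sub)
    with \<open>a \<in> A\<close> show "a \<in> A <+>\<^bsub>R\<^esub> B"
      using semiring_ideal_zero[OF B] unfolding mem_set_add_iff by blast
  qed
  show "B \<subseteq> A <+>\<^bsub>R\<^esub> B"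
  proof
    fix b assume "b \<in> B"
    then have "b = \<zero> \<oplus> b" by (simp add: sub)
    with \<open>b \<in> B\<close> show "b \<in> A <+>\<^bsub>R\<^esub> B"
      using semiring_ideal_zero[OF A] unfolding mem_set_add_iff by blast
  qed
qed

text \<open>Equal classes only yield an equation \<open>r \<oplus> i = x \<oplus> j\<close> with
  \<open>i\<close> and \<open>j\<close> in \<open>I\<close>. There is no subtraction, so it is the
  k-property of \<open>J\<close> that removes \<open>i\<close> and recovers \<open>r\<close> itself.
  Hence membership in \<open>quotient_ideal R J I\<close> does not depend on the chosen
  representative.\<close>

lemma bourne_class_in_quotient_ideal_iff:
  assumes I: "semiring_ideal I R" and J: "k_ideal J R" and IJ: "I \<subseteq> J"
    and r: "r \<in> carrier R"
  shows "bourne_class R I r \<in> quotient_ideal R J I \<longleftrightarrow> r \<in> J"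
proof
  note J' = k_ideal_imp_semiring_ideal[OF J]
  note sub = subsetD[OF semiring_ideal_subset[OF J']]
  assume "bourne_class R I r \<in> quotient_ideal R J I"
  then obtain x where x: "x \<in> J" "bourne_class R I r = bourne_class R I x"
    by (auto simp: quotient_ideal_def)
  then have "(r, x) \<in> bourne_rel R I"
    using bourne_class_eq_iff[OF I r] sub by blast
  then obtain i j where ij: "i \<in> I" "j \<in> I" "r \<oplus> i = x \<oplus> j"
    by (auto simp: bourne_rel_def)
  then have "r \<oplus> i \<in> J" using semiring_ideal_add[OF J'] x IJ by auto
  then show "r \<in> J" using k_ideal_cancel[OF J r] ij IJ sub by blast
qed (simp add: quotient_ideal_def)

lemma k_ideal_quotient_ideal:
  assumes I: "semiring_ideal I R" and J: "k_ideal J R" and IJ: "I \<subseteq> J"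
  shows "k_ideal (quotient_ideal R J I) (bourne_quotient R I)"
proof -
  note J' = k_ideal_imp_semiring_ideal[OF J]
  note sub = subsetD[OF semiring_ideal_subset[OF J']]
  note iff = bourne_class_in_quotient_ideal_iff[OF I J IJ]
  have "semiring_ideal (quotient_ideal R J I) (bourne_quotient R I)"
    unfolding semiring_ideal_def carrier_bourne_quotient
    using semiring_ideal_zero[OF J'] semiring_ideal_add[OF J'] semiring_ideal_mult[OF J']
    by (auto simp: quotient_ideal_def bourne_class_add[OF I] bourne_class_mult[OF I] sub)
  \<comment> \<open>Elements of the quotient are classes, so cancellation is checked on
    representatives, where \<open>iff\<close> turns it into cancellation in
    \<open>J\<close>.\<close>
  moreover have "bourne_class R I x \<in> quotient_ideal R J I"
    if "x \<in> carrier R" "y \<in> carrier R"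
      and "bourne_class R I x \<oplus>\<^bsub>bourne_quotient R I\<^esub> bourne_class R I y \<in> quotient_ideal R J I"
      and "bourne_class R I y \<in> quotient_ideal R J I" for x y
    using that k_ideal_cancel[OF J that(1,2)] by (simp add: bourne_class_add[OF I] iff)
  ultimately show ?thesis
    unfolding k_ideal_def carrier_bourne_quotient by blast
qed

text \<open>The map \<open>bourne_class R I\<close> is a semiring homomorphism, and the preimage of
  a k-ideal under a homomorphism is a k-ideal.\<close>

lemma k_ideal_bourne_preimage:
  assumes I: "semiring_ideal I R" and A: "k_ideal A (bourne_quotient R I)"
  shows "k_ideal {r \<in> carrier R. bourne_class R I r \<in> A} R"
proof -
  note A' = k_ideal_imp_semiring_ideal[OF A]
  interpret Q: comm_semiring "bourne_quotient R I"
    by (rule comm_semiring_bourne_quotient[OF I])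
  have car: "bourne_class R I r \<in> carrier (bourne_quotient R I)" if "r \<in> carrier R" for r
    using that by (simp add: carrier_bourne_quotient)
  \<comment> \<open>This puts \<open>\<zero>\<close> into the preimage, which is therefore
    nonempty.\<close>
  have "bourne_class R I \<zero> \<in> A"
    using Q.semiring_ideal_zero[OF A'] by (simp add: zero_bourne_quotient)
  then have "semiring_ideal {r \<in> carrier R. bourne_class R I r \<in> A} R"
    unfolding semiring_ideal_def
    using semiring_ideal_add[OF A'] semiring_ideal_mult[OF A' car]
    by (auto simp flip: bourne_class_add[OF I] bourne_class_mult[OF I])
  then show ?thesis
    unfolding k_ideal_def using k_ideal_cancel[OF A car car]
    by (auto simp flip: bourne_class_add[OF I])
qed

lemma k_strongly_irreducible_quotient_ideal:
  assumes I: "semiring_ideal I R" and J: "k_strongly_irreducible J R" and IJ: "I \<subseteq> J"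
  shows "k_strongly_irreducible (quotient_ideal R J I) (bourne_quotient R I)"
proof -
  have kJ: "k_ideal J R" using J by (simp add: k_strongly_irreducible_def)
  note iff = bourne_class_in_quotient_ideal_iff[OF I kJ IJ]
  have "A \<subseteq> quotient_ideal R J I \<or> B \<subseteq> quotient_ideal R J I"
    if A: "k_ideal A (bourne_quotient R I)" and B: "k_ideal B (bourne_quotient R I)"
      and AB: "A \<inter> B \<subseteq> quotient_ideal R J I" for A B
  proof -
    define preim where "preim X = {r \<in> carrier R. bourne_class R I r \<in> X}" for X
    \<comment> \<open>A common element \<open>r\<close> has its class in
      \<open>A \<inter> B\<close>, hence in \<open>quotient_ideal R J I\<close>, and
      \<open>iff\<close> brings \<open>r\<close> back into \<open>J\<close>.\<close>
    have "preim A \<inter> preim B \<subseteq> J"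
      using AB iff by (auto simp: preim_def)
    then have "preim A \<subseteq> J \<or> preim B \<subseteq> J"
      using J k_ideal_bourne_preimage[OF I] A B
      by (simp add: k_strongly_irreducible_def preim_def)
    \<comment> \<open>Every element of \<open>X\<close> is the class of some \<open>r\<close>; this
      \<open>r\<close> lies in \<open>preim X\<close>, hence in \<open>J\<close>.\<close>
    moreover have "X \<subseteq> quotient_ideal R J I"
      if X: "k_ideal X (bourne_quotient R I)" and "preim X \<subseteq> J" for X
      using semiring_ideal_subset[OF k_ideal_imp_semiring_ideal[OF X]] that(2)
      by (auto simp: preim_def carrier_bourne_quotient quotient_ideal_def)
    ultimately show ?thesis using A B by blast
  qed
  then show ?thesis
    using k_ideal_quotient_ideal[OF I kJ IJ] by (simp add: k_strongly_irreducible_def)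
qed

lemma k_strongly_irreducible_of_quotient_ideal:
  assumes I: "semiring_ideal I R" and arith: "arithmetic R" and k: "k_semiring R"
    and J: "semiring_ideal J R" and IJ: "I \<subseteq> J"
    and irr: "k_strongly_irreducible (quotient_ideal R J I) (bourne_quotient R I)"
  shows "k_strongly_irreducible J R"
proof -
  \<comment> \<open>Applied below to \<open>J\<close> and to the sums of \<open>I\<close> with
    \<open>A\<close> and with \<open>B\<close>, so that \<open>iff\<close> is available for all
    three.\<close>
  have kid: "k_ideal X R" if "semiring_ideal X R" for X
    using k that by (simp add: k_semiring_def)
  note iff = bourne_class_in_quotient_ideal_iff[OF I]
  have "A \<subseteq> J \<or> B \<subseteq> J" if "k_ideal A R" "k_ideal B R" and AB: "A \<inter> B \<subseteq> J" for A B
  proof -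
    have A: "semiring_ideal A R" and B: "semiring_ideal B R"
      using that by (simp_all add: k_ideal_def)
    let ?A = "I <+>\<^bsub>R\<^esub> A" and ?B = "I <+>\<^bsub>R\<^esub> B"
    have kA: "k_ideal ?A R" and kB: "k_ideal ?B R"
      using I A B by (simp_all add: kid semiring_ideal_set_add)
    have IA: "I \<subseteq> ?A" and IB: "I \<subseteq> ?B"
      using set_add_superset(1)[OF I] A B by simp_all
    \<comment> \<open>Distributivity of the ideal lattice, with \<open>I\<close> as the common
      summand.\<close>
    have "?A \<inter> ?B = I <+>\<^bsub>R\<^esub> (A \<inter> B)"
      using arith I A B by (simp add: arithmetic_def)
    also have "\<dots> \<subseteq> J"
      using subsetD[OF AB] subsetD[OF IJ] semiring_ideal_add[OF J] by (auto simp: mem_set_add_iff)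
    finally have ABJ: "?A \<inter> ?B \<subseteq> J" .
    \<comment> \<open>An image of an intersection can be smaller than the intersection of the
      images, so a common representative must be found. A representative \<open>a\<close> of
      \<open>c\<close> taken from \<open>?A\<close> also lies in \<open>?B\<close>, because
      \<open>?B\<close> is a k-ideal containing \<open>I\<close>.\<close>
    have "quotient_ideal R ?A I \<inter> quotient_ideal R ?B I \<subseteq> quotient_ideal R J I"
    proof
      fix c assume c: "c \<in> quotient_ideal R ?A I \<inter> quotient_ideal R ?B I"
      then obtain a where a: "a \<in> ?A" "c = bourne_class R I a"
        by (auto simp: quotient_ideal_def)
      then have "a \<in> carrier R"
        using semiring_ideal_subset[OF k_ideal_imp_semiring_ideal[OF kA]] by blast
      then have "a \<in> ?B" using c a iff[OF kB IB] by simp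
      then show "c \<in> quotient_ideal R J I" using a ABJ by (auto simp: quotient_ideal_def)
    qed
    then have "quotient_ideal R ?A I \<subseteq> quotient_ideal R J I
        \<or> quotient_ideal R ?B I \<subseteq> quotient_ideal R J I"
      using irr k_ideal_quotient_ideal[OF I kA IA] k_ideal_quotient_ideal[OF I kB IB]
      by (simp add: k_strongly_irreducible_def)
    \<comment> \<open>Returns from the enlarged ideal to \<open>X\<close>: each \<open>x\<close> in
      \<open>X\<close> lies in the sum of \<open>I\<close> and \<open>X\<close>, so its class is in
      \<open>quotient_ideal R J I\<close>, and the k-property of \<open>J\<close> gives
      \<open>x \<in> J\<close>.\<close>
    moreover have "X \<subseteq> J"
      if X: "semiring_ideal X R" and sub: "quotient_ideal R (I <+>\<^bsub>R\<^esub> X) I \<subseteq> quotient_ideal R J I" for X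
    proof
      fix x assume "x \<in> X"
      then have "bourne_class R I x \<in> quotient_ideal R J I"
        using set_add_superset(2)[OF I X] sub by (auto simp: quotient_ideal_def)
      then show "x \<in> J"
        using iff[OF kid[OF J] IJ] semiring_ideal_subset[OF X] \<open>x \<in> X\<close> by blast
    qed
    ultimately show ?thesis using A B by blast
  qed
  then show ?thesis using kid[OF J] by (simp add: k_strongly_irreducible_def)
qed

end

theorem theorem4p4:
  fixes S :: "('a, 'm) ring_scheme" and I :: "'a set"
  assumes "comm_semiring S" and "semiring_ideal I S"
  shows "(\<forall>J. k_strongly_irreducible J S \<and> I \<subseteq> J \<longrightarrow>
            k_strongly_irreducible (quotient_ideal S J I) (bourne_quotient S I)) \<and>
         (arithmetic S \<and> k_semiring S \<longrightarrow>
            (\<forall>J. semiring_ideal J S \<and> I \<subseteq> J \<and>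
               k_strongly_irreducible (quotient_ideal S J I) (bourne_quotient S I) \<longrightarrow>
               k_strongly_irreducible J S))"
  using comm_semiring.k_strongly_irreducible_quotient_ideal[OF assms]
    comm_semiring.k_strongly_irreducible_of_quotient_ideal[OF assms]
  by blast

end
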